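(* Let $\alpha$ be a hybrid program in $\Delta$-measurement normal form, $\alpha\equiv\mathrm{ctrl}(\hat y);\ \mathrm{plant}_\varepsilon(u);\ \hat y:=*;\ ?(y-\Delta\le\hat y\le y+\Delta)$, and suppose $\alpha$ is $[-\Delta,\Delta]$-contraction-safe for a formula $J$, i.e., $\big(\forall y\,(\hat y-\Delta\le y\le\hat y+\Delta\rightarrow J)\big)\rightarrow[\alpha]\forall y\,(\hat y-\Delta\le y\le\hat y+\Delta\rightarrow J)$ is valid. Let $\omega,\nu$ be states that agree on all variables not in $\mathrm{BV}(\alpha)$, with non-faulty sensors, i.e., $\hat y-\Delta\le y\le\hat y+\Delta$ holds in both $\omega$ and $\nu$. Suppose $\omega\models\forall y\,(\hat y-\Delta\le y\le\hat y+\Delta\rightarrow J)$ and $(\omega,\nu)\models\chi_m$ where $$\chi_m\equiv\exists y\,\big(\hat y-\Delta\le y\le\hat y+\Delta\wedge\langle\alpha\rangle\exists y^+\,\Upsilon^+\big).$$ Then $\nu\models J$.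
   Context: Differential dynamic logic (dL): states are maps $\omega$ from a set of real-valued variables to $\mathbb{R}$. Hybrid programs are built from assignments $x:=\theta$, nondeterministic assignments $x:=*$ (any real value), tests $?F$ (continue only if $F$ holds, otherwise abort), differential equations $\{x'=\theta\ \&\ Q\}$ (evolve for any nonnegative duration while staying in $Q$), sequential composition $;$, nondeterministic choice $\cup$ and repetition $^*$; each program denotes a transition relation $[\![\alpha]\!]$ on states. dL formulas extend first-order real arithmetic with $[\alpha]\phi$ ($\phi$ holds after all runs of $\alpha$) and $\langle\alpha\rangle\phi$ ($\phi$ holds after some run); valid means true in all states. $\mathrm{BV}(\alpha)$ are the bound variables of $\alpha$. Here $y$ is an unobservable state variable, $\hat y$ its measurement with uncertainty $\Delta\ge0$, $\mathrm{ctrl}(\hat y)$ a controller program computing control output $u$ from the measurement, and $\mathrm{plant}_\varepsilon(u)$ abbreviates $t:=0;\{x'=f(x,u),t'=1\ \&\ t\le\varepsilon\};?t=\varepsilon$ (the plant, whose state includes $y$, runs for time $\varepsilon$). For every variable $x$ there is a fresh variable $x^+$; $\Upsilon^+$ abbreviates the conjunction of $x^+=x$ over all $x\in\mathrm{BV}(\alpha)$. Transition satisfaction: $(\omega,\nu)\models\phi$ iff $\phi$ is true in the state that agrees with $\omega$ except that each $x^+$ has value $\nu(x)$. *)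

theory Defs
  imports Complex_Main
begin

section \<open>Syntax of differential dynamic logic\<close>

text \<open>
  Syntax and semantics are parametric in the type \<open>'x\<close> of variables.  The functions
  \<open>vars_trm\<close>, \<open>vars_fml\<close>, \<open>vars_hp\<close> collect all variables that occur syntactically,
  free or bound.
\<close>

datatype (vars_trm: 'x) trm =
    Var 'x
  | Const real
  | Neg "'x trm"
  | Add "'x trm" "'x trm"
  | Sub "'x trm" "'x trm"
  | Mul "'x trm" "'x trm"

text \<open>
  The list in \<open>ODE [(x1, e1), ..., (xn, en)] Q\<close> stands for the system
  \<open>x1' = e1, ..., xn' = en & Q\<close>.
\<close>

datatype (vars_fml: 'x) fml =
    FTrue
  | Eq "'x trm" "'x trm"
  | Le "'x trm" "'x trm"
  | Less "'x trm" "'x trm"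
  | FNot "'x fml"
  | FAnd "'x fml" "'x fml"
  | FOr "'x fml" "'x fml"
  | FImp "'x fml" "'x fml"
  | Forall 'x "'x fml"
  | Exists 'x "'x fml"
  | Box "'x hp" "'x fml"
  | Diamond "'x hp" "'x fml"
and (vars_hp: 'x) hp =
    Assign 'x "'x trm"
  | AssignAny 'x
  | Test "'x fml"
  | ODE "('x \<times> 'x trm) list" "'x fml"
  | Seq "'x hp" "'x hp"  (infixr \<open>;;\<close> 60)
  | Choice "'x hp" "'x hp"
  | Star "'x hp"

primrec BV :: "'x hp \<Rightarrow> 'x set" where
  "BV (Assign x e) = {x}"
| "BV (AssignAny x) = {x}"
| "BV (Test F) = {}"
| "BV (ODE eqs Q) = fst ` set eqs"
| "BV (a ;; b) = BV a \<union> BV b"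
| "BV (Choice a b) = BV a \<union> BV b"
| "BV (Star a) = BV a"


section \<open>Semantics\<close>

type_synonym 'x state = "'x \<Rightarrow> real"

primrec trm_sem :: "'x trm \<Rightarrow> 'x state \<Rightarrow> real" where
  "trm_sem (Var x) \<omega> = \<omega> x"
| "trm_sem (Const c) \<omega> = c"
| "trm_sem (Neg e) \<omega> = - trm_sem e \<omega>"
| "trm_sem (Add e1 e2) \<omega> = trm_sem e1 \<omega> + trm_sem e2 \<omega>"
| "trm_sem (Sub e1 e2) \<omega> = trm_sem e1 \<omega> - trm_sem e2 \<omega>"
| "trm_sem (Mul e1 e2) \<omega> = trm_sem e1 \<omega> * trm_sem e2 \<omega>"

text \<open>
  For a differential equation, the solution \<open>\<Phi>\<close> on \<open>[0, r]\<close> is a flow of states; derivatives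
  are one-sided at the end points, and for \<open>r = 0\<close> the derivative condition is void.
\<close>

primrec fml_sem :: "'x fml \<Rightarrow> 'x state \<Rightarrow> bool"
  and hp_sem :: "'x hp \<Rightarrow> ('x state \<times> 'x state) set" where
  "fml_sem FTrue \<omega> = True"
| "fml_sem (Eq e1 e2) \<omega> = (trm_sem e1 \<omega> = trm_sem e2 \<omega>)"
| "fml_sem (Le e1 e2) \<omega> = (trm_sem e1 \<omega> \<le> trm_sem e2 \<omega>)"
| "fml_sem (Less e1 e2) \<omega> = (trm_sem e1 \<omega> < trm_sem e2 \<omega>)"
| "fml_sem (FNot F) \<omega> = (\<not> fml_sem F \<omega>)"
| "fml_sem (FAnd F G) \<omega> = (fml_sem F \<omega> \<and> fml_sem G \<omega>)"
| "fml_sem (FOr F G) \<omega> = (fml_sem F \<omega> \<or> fml_sem G \<omega>)"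
| "fml_sem (FImp F G) \<omega> = (fml_sem F \<omega> \<longrightarrow> fml_sem G \<omega>)"
| "fml_sem (Forall x F) \<omega> = (\<forall>d. fml_sem F (\<omega>(x := d)))"
| "fml_sem (Exists x F) \<omega> = (\<exists>d. fml_sem F (\<omega>(x := d)))"
| "fml_sem (Box a F) \<omega> = (\<forall>\<nu>. (\<omega>, \<nu>) \<in> hp_sem a \<longrightarrow> fml_sem F \<nu>)"
| "fml_sem (Diamond a F) \<omega> = (\<exists>\<nu>. (\<omega>, \<nu>) \<in> hp_sem a \<and> fml_sem F \<nu>)"
| "hp_sem (Assign x e) = {(\<omega>, \<nu>). \<nu> = \<omega>(x := trm_sem e \<omega>)}"
| "hp_sem (AssignAny x) = {(\<omega>, \<nu>). \<exists>d. \<nu> = \<omega>(x := d)}"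
| "hp_sem (Test F) = {(\<omega>, \<nu>). \<nu> = \<omega> \<and> fml_sem F \<omega>}"
| "hp_sem (ODE eqs Q) =
     {(\<omega>, \<nu>). \<exists>r \<Phi>. 0 \<le> r \<and> \<Phi> 0 = \<omega> \<and> \<Phi> r = \<nu> \<and>
        (\<forall>s\<in>{0..r}. fml_sem Q (\<Phi> s) \<and>
           (\<forall>(x, e)\<in>set eqs.
              ((\<lambda>\<tau>. \<Phi> \<tau> x) has_real_derivative trm_sem e (\<Phi> s)) (at s within {0..r})) \<and>
           (\<forall>z. z \<notin> fst ` set eqs \<longrightarrow> \<Phi> s z = \<omega> z))}"
| "hp_sem (a ;; b) = hp_sem a O hp_sem b"
| "hp_sem (Choice a b) = hp_sem a \<union> hp_sem b"
| "hp_sem (Star a) = (hp_sem a)\<^sup>*"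

definition valid :: "'x fml \<Rightarrow> bool" where
  "valid F \<longleftrightarrow> (\<forall>\<omega>. fml_sem F \<omega>)"


section \<open>Measurement normal form and contraction safety\<close>

definition plant :: "'x \<Rightarrow> ('x \<times> 'x trm) list \<Rightarrow> 'x trm \<Rightarrow> 'x hp" where
  "plant t eqs \<epsilon> =
     Assign t (Const 0) ;;
     ODE (eqs @ [(t, Const 1)]) (Le (Var t) \<epsilon>) ;;
     Test (Eq (Var t) \<epsilon>)"

definition measurement :: "'x trm \<Rightarrow> 'x \<Rightarrow> 'x \<Rightarrow> 'x fml" where
  "measurement \<Delta> y yh =
     FAnd (Le (Sub (Var y) \<Delta>) (Var yh)) (Le (Var yh) (Add (Var y) \<Delta>))"

definition uncertainty :: "'x trm \<Rightarrow> 'x \<Rightarrow> 'x \<Rightarrow> 'x fml" where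
  "uncertainty \<Delta> y yh =
     FAnd (Le (Sub (Var yh) \<Delta>) (Var y)) (Le (Var y) (Add (Var yh) \<Delta>))"

text \<open>
  \<open>measurement_nf \<Delta> y yh \<alpha>\<close>: the program \<open>\<alpha>\<close> is in \<open>\<Delta>\<close>-measurement normal form for the
  unobservable variable \<open>y\<close> with measurement \<open>yh\<close>.  The system \<open>eqs\<close> is \<open>x' = f(x, u)\<close>, and
  the list \<open>us\<close> holds the control outputs \<open>u\<close>, which stay constant during the plant.
  The uncertainty \<open>\<Delta>\<close> and the cycle time \<open>\<epsilon>\<close> are terms (number literals or symbolic parameters,
  say) whose value \<open>\<alpha>\<close> does not change; the right-hand sides \<open>f(x, u)\<close> may also mention
  such parameters.  That \<open>y\<close> is unobservable means that it does not occur in the controller.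
\<close>

definition measurement_nf :: "'x trm \<Rightarrow> 'x \<Rightarrow> 'x \<Rightarrow> 'x hp \<Rightarrow> bool" where
  "measurement_nf \<Delta> y yh \<alpha> \<longleftrightarrow>
     (\<exists>ctrl us t eqs \<epsilon>.
        \<alpha> = ctrl ;; plant t eqs \<epsilon> ;; AssignAny yh ;; Test (measurement \<Delta> y yh) \<and>
        y \<notin> vars_hp ctrl \<and>
        set us \<subseteq> BV ctrl \<and>
        distinct (map fst eqs) \<and> y \<in> fst ` set eqs \<and>
        t \<notin> fst ` set eqs \<and> yh \<notin> insert t (fst ` set eqs) \<and>
        set us \<inter> insert t (fst ` set eqs) = {} \<and>
        (\<forall>(x, e)\<in>set eqs. vars_trm e \<inter> BV \<alpha> \<subseteq> fst ` set eqs \<union> set us) \<and>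
        vars_trm \<Delta> \<inter> BV \<alpha> = {} \<and> vars_trm \<epsilon> \<inter> BV \<alpha> = {})"

definition contraction_safe :: "'x trm \<Rightarrow> 'x \<Rightarrow> 'x \<Rightarrow> 'x hp \<Rightarrow> 'x fml \<Rightarrow> bool" where
  "contraction_safe \<Delta> y yh \<alpha> J \<longleftrightarrow>
     valid (FImp (Forall y (FImp (uncertainty \<Delta> y yh) J))
                 (Box \<alpha> (Forall y (FImp (uncertainty \<Delta> y yh) J))))"


section \<open>Transition satisfaction and the monitor condition\<close>

text \<open>The variable \<open>Post x\<close> is \<open>x\<^sup>+\<close>.\<close>

datatype 'v var = Base 'v | Post "'v var"

definition post_fresh :: "'v var set \<Rightarrow> bool" where
  "post_fresh X \<longleftrightarrow> X \<inter> range Post = {}"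

definition trans_state :: "'v var state \<Rightarrow> 'v var state \<Rightarrow> 'v var state" where
  "trans_state \<omega> \<nu> = (\<lambda>z. case z of Base v \<Rightarrow> \<omega> (Base v) | Post x \<Rightarrow> \<nu> x)"

definition trans_sat :: "'v var state \<Rightarrow> 'v var state \<Rightarrow> 'v var fml \<Rightarrow> bool" where
  "trans_sat \<omega> \<nu> F \<longleftrightarrow> fml_sem F (trans_state \<omega> \<nu>)"

text \<open>
  The conjunction \<open>\<Upsilon>\<^sup>+\<close> ranges over the finite set \<open>BV \<alpha>\<close>; the conjuncts are
  taken in an arbitrary order, which is irrelevant for the semantics.
\<close>

lemma finite_BV: "finite (BV a)"
  by (rule hp.induct[of "\<lambda>_. True"]) auto

definition Upsilon :: "'v var hp \<Rightarrow> 'v var fml" where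
  "Upsilon \<alpha> =
     foldr FAnd
       (map (\<lambda>x. Eq (Var (Post x)) (Var x)) (SOME xs. set xs = BV \<alpha> \<and> distinct xs))
       FTrue"

definition chi_m :: "'v var trm \<Rightarrow> 'v var \<Rightarrow> 'v var \<Rightarrow> 'v var hp \<Rightarrow> 'v var fml" where
  "chi_m \<Delta> y yh \<alpha> =
     Exists y (FAnd (uncertainty \<Delta> y yh) (Diamond \<alpha> (Exists (Post y) (Upsilon \<alpha>))))"

end

theory Submission imports Defs begin

text \<open>
  A witness for \<open>\<chi>\<^sub>m\<close> is a run of \<open>\<alpha>\<close> from \<open>\<omega>\<close> with the value of \<open>y\<close> replaced, by one that is
  compatible with the measurement. Its final state agrees with \<open>\<nu>\<close> on all unprimed variables other
  than \<open>y\<close>: on bound ones because of \<open>\<Upsilon>\<^sup>+\<close>, on the others because neither the run nor the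
  transition from \<open>\<omega>\<close> to \<open>\<nu>\<close> changes them. The formula \<open>\<forall>y (\<dots> \<longrightarrow> J)\<close> does not depend on \<open>y\<close>, so
  it holds initially, is preserved by contraction safety, and transfers to \<open>\<nu>\<close>, where its premise
  holds for the actual value of \<open>y\<close>.
\<close>

lemma trm_coincidence:
  "vars_trm e \<subseteq> V \<Longrightarrow> \<forall>x\<in>V. \<omega> x = \<omega>' x \<Longrightarrow> trm_sem e \<omega> = trm_sem e \<omega>'"
  by (induction e) auto

lemma hp_sem_bound_effect:
  "(\<omega>, \<nu>) \<in> hp_sem a \<Longrightarrow> x \<notin> BV a \<Longrightarrow> \<nu> x = \<omega> x"
\<comment> \<open>The predicate for formulas is trivial: tests and evolution domains only restrict
  runs, they never change a variable.\<close>
proof (induction a arbitrary: \<omega> \<nu> rule: hp.induct[of "\<lambda>_. True"])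
  case (Star a)
  from Star.prems(1) have "(\<omega>, \<nu>) \<in> (hp_sem a)\<^sup>*" by simp
  then show ?case
  proof (induction rule: rtrancl_induct)
    case (step \<mu> \<nu>)
    have "\<nu> x = \<mu> x" using Star.IH[OF step.hyps(2)] Star.prems(2) by simp
    with step.IH show ?case by simp
  qed simp
next
  case (ODE eqs Q)
  from ODE.prems show ?case
    unfolding hp_sem.simps BV.simps mem_Collect_eq prod.case
    \<comment> \<open>The end time \<open>r\<close> lies in \<open>{0..r}\<close>, so the constancy
      clause applies to the final state.\<close>
    by (metis atLeastAtMost_iff order_refl)
next
  case (Seq a b)
  then obtain \<mu> where "(\<omega>, \<mu>) \<in> hp_sem a" "(\<mu>, \<nu>) \<in> hp_sem b" by auto
  then show ?case
    using Seq.IH(1)[of \<omega> \<mu>] Seq.IH(2)[of \<mu> \<nu>] Seq.prems(2) by simp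
qed auto

text \<open>A program neither reads nor writes outside \<open>V\<close>, so a run can be replayed
  from \<omega>': the new end state follows \<nu> on \<open>V\<close> and keeps \<omega>' elsewhere.
  Naming this state explicitly makes replayed runs compose. Fixing any superset \<open>V\<close> of
  the variables, rather than the exact set, lets the induction hypotheses share one
  \<open>V\<close>.\<close>

lemma coincidence:
  "vars_fml F \<subseteq> V \<Longrightarrow> (\<forall>x\<in>V. \<omega> x = \<omega>' x) \<Longrightarrow> fml_sem F \<omega> = fml_sem F \<omega>'"
  "vars_hp a \<subseteq> V \<Longrightarrow> (\<forall>x\<in>V. \<omega> x = \<omega>' x) \<Longrightarrow> (\<omega>, \<nu>) \<in> hp_sem a
     \<Longrightarrow> (\<omega>', override_on \<omega>' \<nu> V) \<in> hp_sem a"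
proof (induction F and a arbitrary: \<omega> \<omega>' and \<omega> \<omega>' \<nu> rule: fml.induct hp.induct)
  case (Eq e1 e2)
  then show ?case
    using trm_coincidence[of e1 V \<omega> \<omega>'] trm_coincidence[of e2 V \<omega> \<omega>'] by simp
next
  case (Le e1 e2)
  then show ?case
    using trm_coincidence[of e1 V \<omega> \<omega>'] trm_coincidence[of e2 V \<omega> \<omega>'] by simp
next
  case (Less e1 e2)
  then show ?case
    using trm_coincidence[of e1 V \<omega> \<omega>'] trm_coincidence[of e2 V \<omega> \<omega>'] by simp
next
  case (Forall x F)
  have "fml_sem F (\<omega>(x := d)) = fml_sem F (\<omega>'(x := d))" for d
    using Forall.prems by (intro Forall.IH) auto
  then show ?case by simp
next
  case (Exists x F)
  have "fml_sem F (\<omega>(x := d)) = fml_sem F (\<omega>'(x := d))" for d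
    using Exists.prems by (intro Exists.IH) auto
  then show ?case by simp
next
  case (Box a F)
  \<comment> \<open>Stated for arbitrary start states because runs must be matched in both
    directions.\<close>
  have *: "\<exists>\<nu>'. (\<omega>2, \<nu>') \<in> hp_sem a \<and> fml_sem F \<nu>' = fml_sem F \<nu>"
    if "\<forall>x\<in>V. \<omega>1 x = \<omega>2 x" "(\<omega>1, \<nu>) \<in> hp_sem a" for \<omega>1 \<omega>2 \<nu>
    using Box.IH(1)[OF _ that] Box.IH(2)[of "override_on \<omega>2 \<nu> V" \<nu>] Box.prems(1) by auto
  show ?case
    using *[of \<omega> \<omega>'] *[of \<omega>' \<omega>] Box.prems(2) by (simp, metis)
next
  case (Diamond a F)
  have *: "\<exists>\<nu>'. (\<omega>2, \<nu>') \<in> hp_sem a \<and> fml_sem F \<nu>' = fml_sem F \<nu>"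
    if "\<forall>x\<in>V. \<omega>1 x = \<omega>2 x" "(\<omega>1, \<nu>) \<in> hp_sem a" for \<omega>1 \<omega>2 \<nu>
    using Diamond.IH(1)[OF _ that] Diamond.IH(2)[of "override_on \<omega>2 \<nu> V" \<nu>] Diamond.prems(1)
    by auto
  show ?case
    using *[of \<omega> \<omega>'] *[of \<omega>' \<omega>] Diamond.prems(2) by (simp, metis)
next
  case (Assign x e)
  then have "trm_sem e \<omega> = trm_sem e \<omega>'" by (intro trm_coincidence[of e V]) auto
  with Assign show ?case by (auto simp: override_on_def fun_eq_iff)
next
  case (AssignAny x)
  then obtain d where "\<nu> = \<omega>(x := d)" by auto
  with AssignAny.prems have "override_on \<omega>' \<nu> V = \<omega>'(x := d)"
    by (auto simp: override_on_def fun_eq_iff)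
  then show ?case unfolding hp_sem.simps by blast
next
  case (Test F)
  have "fml_sem F \<omega> = fml_sem F \<omega>'"
    using Test.IH[of \<omega> \<omega>'] Test.prems(1,2) by simp
  with Test.prems show ?case by (auto simp: override_on_def fun_eq_iff)
next
  case (ODE eqs Q)
  from ODE.prems(3) obtain r \<Phi> where r: "0 \<le> r" and \<Phi>: "\<Phi> 0 = \<omega>" "\<Phi> r = \<nu>"
    and sol: "\<forall>s\<in>{0..r}. fml_sem Q (\<Phi> s) \<and>
      (\<forall>(x, e)\<in>set eqs.
        ((\<lambda>\<tau>. \<Phi> \<tau> x) has_real_derivative trm_sem e (\<Phi> s)) (at s within {0..r})) \<and>
      (\<forall>z. z \<notin> fst ` set eqs \<longrightarrow> \<Phi> s z = \<omega> z)"
    unfolding hp_sem.simps mem_Collect_eq prod.case by blast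
  \<comment> \<open>The flow is frozen at \<omega>' outside \<open>V\<close>. All evolving variables
    lie in \<open>V\<close>, so their derivatives are those of \<Phi>.\<close>
  define \<Psi> where "\<Psi> s = override_on \<omega>' (\<Phi> s) V" for s
  have vars: "x \<in> V" "vars_trm e \<subseteq> V" if "(x, e) \<in> set eqs" for x e
    using ODE.prems(1) that by (force simp: prod_set_defs)+
  have "\<Psi> 0 = \<omega>'"
    using ODE.prems(2) \<Phi> by (auto simp: \<Psi>_def override_on_def fun_eq_iff)
  moreover have "\<Psi> r = override_on \<omega>' \<nu> V"
    using \<Phi> by (simp add: \<Psi>_def)
  moreover have "\<forall>s\<in>{0..r}. fml_sem Q (\<Psi> s) \<and>
      (\<forall>(x, e)\<in>set eqs.
        ((\<lambda>\<tau>. \<Psi> \<tau> x) has_real_derivative trm_sem e (\<Psi> s)) (at s within {0..r})) \<and>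
      (\<forall>z. z \<notin> fst ` set eqs \<longrightarrow> \<Psi> s z = \<omega>' z)"
  proof (intro ballI conjI allI impI, goal_cases)
    case (1 s)
    then show ?case
      using ODE.IH[of "\<Phi> s" "\<Psi> s"] ODE.prems(1) sol by (simp add: \<Psi>_def)
  next
    case (2 s xe)
    obtain x e where xe: "xe = (x, e)" by fastforce
    have "trm_sem e (\<Psi> s) = trm_sem e (\<Phi> s)"
      using vars[of x e] 2 xe by (intro trm_coincidence[of e V]) (auto simp: \<Psi>_def)
    moreover have "((\<lambda>\<tau>. \<Phi> \<tau> x) has_real_derivative trm_sem e (\<Phi> s)) (at s within {0..r})"
      using sol 2 xe by blast
    ultimately show ?case
      using vars(1)[of x e] 2 xe by (simp add: \<Psi>_def)
  next
    case (3 s z)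
    then have "\<Phi> s z = \<omega> z" using sol by blast
    then show ?case
      using ODE.prems(2) by (simp add: \<Psi>_def override_on_def)
  qed
  ultimately show ?case
    unfolding hp_sem.simps mem_Collect_eq prod.case using r by blast
next
  case (Seq a b)
  then obtain \<mu> where \<mu>: "(\<omega>, \<mu>) \<in> hp_sem a" "(\<mu>, \<nu>) \<in> hp_sem b" by auto
  have "(\<omega>', override_on \<omega>' \<mu> V) \<in> hp_sem a"
    using Seq.IH(1) Seq.prems \<mu>(1) by simp
  moreover have "(override_on \<omega>' \<mu> V, override_on (override_on \<omega>' \<mu> V) \<nu> V) \<in> hp_sem b"
    using Seq.prems \<mu>(2) by (intro Seq.IH(2)) auto
  moreover have "override_on (override_on \<omega>' \<mu> V) \<nu> V = override_on \<omega>' \<nu> V"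
    by (auto simp: override_on_def)
  ultimately show ?case by auto
next
  case (Choice a b)
  from Choice.prems(3) consider "(\<omega>, \<nu>) \<in> hp_sem a" | "(\<omega>, \<nu>) \<in> hp_sem b" by auto
  then show ?case using Choice.IH Choice.prems by cases simp_all
next
  case (Star a)
  from Star.prems(3) have "(\<omega>, \<nu>) \<in> (hp_sem a)\<^sup>*" by simp
  then have "(\<omega>', override_on \<omega>' \<nu> V) \<in> (hp_sem a)\<^sup>*"
  proof (induction rule: rtrancl_induct)
    case base
    have "override_on \<omega>' \<omega> V = \<omega>'"
      using Star.prems(2) by (auto simp: override_on_def fun_eq_iff)
    then show ?case by simp
  next
    case (step \<mu> \<nu>)
    \<comment> \<open>The replayed state agrees with \<mu> on \<open>V\<close>, so the next
      iteration can be replayed from it; the nested overrides then collapse.\<close>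
    have "(override_on \<omega>' \<mu> V, override_on (override_on \<omega>' \<mu> V) \<nu> V) \<in> hp_sem a"
      using Star.prems(1) step.hyps(2) by (intro Star.IH) auto
    moreover have "override_on (override_on \<omega>' \<mu> V) \<nu> V = override_on \<omega>' \<nu> V"
      by (auto simp: override_on_def)
    ultimately show ?case using step.IH by simp
  qed
  then show ?case by simp
next
  case (FAnd F G)
  have "fml_sem F \<omega> = fml_sem F \<omega>'" "fml_sem G \<omega> = fml_sem G \<omega>'"
    using FAnd.IH(1)[of \<omega> \<omega>'] FAnd.IH(2)[of \<omega> \<omega>'] FAnd.prems by simp_all
  then show ?case by simp
next
  case (FOr F G)
  have "fml_sem F \<omega> = fml_sem F \<omega>'" "fml_sem G \<omega> = fml_sem G \<omega>'"
    using FOr.IH(1)[of \<omega> \<omega>'] FOr.IH(2)[of \<omega> \<omega>'] FOr.prems by simp_all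
  then show ?case by simp
next
  case (FImp F G)
  have "fml_sem F \<omega> = fml_sem F \<omega>'" "fml_sem G \<omega> = fml_sem G \<omega>'"
    using FImp.IH(1)[of \<omega> \<omega>'] FImp.IH(2)[of \<omega> \<omega>'] FImp.prems by simp_all
  then show ?case by simp
next
  case (FNot F)
  then show ?case using FNot.IH[of \<omega> \<omega>'] by simp
qed simp

lemma fml_sem_cong:
  "(\<And>x. x \<in> vars_fml F \<Longrightarrow> \<omega> x = \<omega>' x) \<Longrightarrow> fml_sem F \<omega> = fml_sem F \<omega>'"
  using coincidence(1)[of F "vars_fml F"] by auto

lemma fml_sem_Forall_cong:
  assumes "\<And>x. x \<in> vars_fml F \<Longrightarrow> x \<noteq> y \<Longrightarrow> \<omega> x = \<omega>' x"
  shows "fml_sem (Forall y F) \<omega> = fml_sem (Forall y F) \<omega>'"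
proof -
  have "fml_sem F (\<omega>(y := d)) = fml_sem F (\<omega>'(y := d))" for d
    using assms by (intro fml_sem_cong) auto
  then show ?thesis by simp
qed

lemma fml_sem_Upsilon:
  "fml_sem (Upsilon \<alpha>) \<omega> \<longleftrightarrow> (\<forall>x\<in>BV \<alpha>. \<omega> (Post x) = \<omega> x)"
proof -
  define xs where "xs = (SOME xs. set xs = BV \<alpha> \<and> distinct xs)"
  have "set xs = BV \<alpha> \<and> distinct xs"
    unfolding xs_def by (rule someI_ex) (rule finite_distinct_list[OF finite_BV])
  moreover have "fml_sem (foldr FAnd (map (\<lambda>x. Eq (Var (Post x)) (Var x)) ys) FTrue) \<omega>
      \<longleftrightarrow> (\<forall>x\<in>set ys. \<omega> (Post x) = \<omega> x)" for ys
    by (induction ys) auto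
  ultimately show ?thesis by (simp add: Upsilon_def xs_def)
qed

lemma BV_subset_vars: "BV a \<subseteq> vars_hp a"
  by (rule hp.induct[of "\<lambda>_. True"]) (auto simp: prod_set_defs intro!: bexI)

theorem theorem4:
  fixes \<alpha> :: "'v var hp" and J :: "'v var fml" and \<Delta> :: "'v var trm"
    and y yh :: "'v var" and \<omega> \<nu> :: "'v var state"
  assumes "measurement_nf \<Delta> y yh \<alpha>"
    and "post_fresh (vars_hp \<alpha>)" and "post_fresh (vars_fml J)"
    and "contraction_safe \<Delta> y yh \<alpha> J"
    and "trm_sem \<Delta> \<omega> \<ge> 0"
    and "\<forall>x. x \<notin> BV \<alpha> \<longrightarrow> \<omega> x = \<nu> x"
    and "fml_sem (uncertainty \<Delta> y yh) \<omega>" and "fml_sem (uncertainty \<Delta> y yh) \<nu>"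
    and "fml_sem (Forall y (FImp (uncertainty \<Delta> y yh) J)) \<omega>"
    and "trans_sat \<omega> \<nu> (chi_m \<Delta> y yh \<alpha>)"
  shows "fml_sem J \<nu>"
proof -
  let ?K = "FImp (uncertainty \<Delta> y yh) J"
  let ?\<omega> = "trans_state \<omega> \<nu>"
  have yBV: "y \<in> BV \<alpha>"
    using assms(1) unfolding measurement_nf_def plant_def by (elim exE conjE) simp
  \<comment> \<open>The final test of the normal form mentions \<Delta>, \<open>y\<close> and
    \<open>yh\<close>, so freshness of \<alpha> carries over to \<open>uncertainty\<close>.\<close>
  have vars: "vars_fml (uncertainty \<Delta> y yh) \<subseteq> vars_hp \<alpha>"
    using assms(1)
    by (auto simp: measurement_nf_def plant_def measurement_def uncertainty_def)
  have K_base: "x \<notin> range Post" if "x \<in> vars_fml ?K" for x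
    using that vars assms(2,3) by (auto simp: post_fresh_def)
  have BV_base: "x \<notin> range Post" if "x \<in> BV \<alpha>" for x
    using that BV_subset_vars[of \<alpha>] assms(2) by (auto simp: post_fresh_def)
  have base: "?\<omega> x = \<omega> x" if "x \<notin> range Post" for x
    using that by (cases x) (auto simp: trans_state_def)
  from assms(10) obtain d \<mu> e
    where run: "(?\<omega>(y := d), \<mu>) \<in> hp_sem \<alpha>"
      and "fml_sem (Upsilon \<alpha>) (\<mu>(Post y := e))"
    unfolding trans_sat_def chi_m_def by auto
  \<comment> \<open>Here \<open>d\<close> is the guessed value of \<open>y\<close>, and
    \<open>e\<close> the value chosen for \<open>Post y\<close>. Only the equation for
    \<open>y\<close> itself is affected by \<open>e\<close>, so \<mu> and \<nu> may differ at
    \<open>y\<close>.\<close>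
  then have ups: "(\<mu>(Post y := e)) (Post x) = (\<mu>(Post y := e)) x" if "x \<in> BV \<alpha>" for x
    using that by (auto simp: fml_sem_Upsilon)
  have final: "\<mu> x = \<nu> x" if "x \<notin> range Post" "x \<noteq> y" for x
  proof (cases "x \<in> BV \<alpha>")
    case True
    have "\<mu> x = \<mu> (Post x)"
      using ups[OF True] that by auto
    \<comment> \<open>By freshness, \<alpha> binds no \<open>Post\<close> variable, so the run
      preserves the copy of \<nu> stored there.\<close>
    also have "\<dots> = (?\<omega>(y := d)) (Post x)"
      using hp_sem_bound_effect[OF run] BV_base by blast
    also have "\<dots> = \<nu> x"
      using BV_base[OF yBV] by (auto simp: trans_state_def)
    finally show ?thesis .
  next
    case False
    then show ?thesis
      using hp_sem_bound_effect[OF run False] that base[OF that(1)] assms(6) by simp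
  qed
  have "fml_sem (Forall y ?K) (?\<omega>(y := d))"
    using assms(9) fml_sem_Forall_cong[of ?K y "?\<omega>(y := d)" \<omega>] K_base base by simp
  then have "fml_sem (Forall y ?K) \<mu>"
    using assms(4) run unfolding contraction_safe_def valid_def by (metis fml_sem.simps(8,11))
  then have "fml_sem (Forall y ?K) \<nu>"
    using fml_sem_Forall_cong[of ?K y \<mu> \<nu>] K_base final by blast
  \<comment> \<open>Instantiating the quantifier with the actual value of \<open>y\<close> gives
    back \<nu>.\<close>
  then have "fml_sem ?K (\<nu>(y := \<nu> y))"
    unfolding fml_sem.simps(9) by blast
  with assms(8) show ?thesis by simp
qed

end
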